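(* Let $\Sigma$ be a set and $\Sigma_\tau=\Sigma+\{\tau\}$. The monad $\mathcal{CM}(\Sigma_\tau\times\mathcal{I}d)$ on $\mathsf{Set}$ (described in the context) is an ordered saturation monad.
   Context: $\mathcal{M}X$: finitely supported $\phi:X\to[0,\infty)$, written $\sum_x\phi(x)\cdot x$; $\mathcal{CM}X$: non-empty convex subsets of $\mathcal{M}X$ (closed under $\sum a_i\phi_i$, $a_i\ge0$, $\sum a_i=1$); $\mathcal{CM}f(U)=\{\mathcal{M}f(\phi)\mid\phi\in U\}$. For $\sigma\in\Sigma_\tau$ and $\psi\in\mathcal{M}(\Sigma_\tau\times Z)$ let $\rho_\tau(\psi)=\psi$ and, for $\sigma\ne\tau$, $\rho_\sigma(\psi)=\sum_z\psi(\tau,z)\cdot(\sigma,z)$. The monad $\mathcal{CM}(\Sigma_\tau\times\mathcal{I}d)$ has Kleisli identities $x\mapsto\{1\cdot(\tau,x)\}$ and Kleisli composition of $f:X\to\mathcal{CM}(\Sigma_\tau\times Y)$, $g:Y\to\mathcal{CM}(\Sigma_\tau\times Z)$ given by $g\bullet f(x)=\bigcup_{\phi\in f(x)}\sum_{(\sigma,y)\in\mathrm{supp}(\phi)}\{\phi(\sigma,y)\cdot\rho_\sigma(\psi)\mid\psi\in g(y)\}$ (Minkowski sums, empty sum $\{0\}$); for a map $f:X\to Y$, $f^\sharp(x)=\{1\cdot(\tau,f(x))\}$. Kleisli hom-sets are ordered by pointwise inclusion. Ordered saturation monad: Kleisli hom-sets are posets with monotone composition and for each $\alpha:X\to\mathcal{CM}(\Sigma_\tau\times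 X)$ there is $\alpha^\star$ with (1) $1\le\alpha^\star$; (2) $\alpha\le\alpha^\star$; (3) $\alpha^\star\bullet\alpha^\star\le\alpha^\star$; (4) $\alpha^\star\le\beta$ whenever $1\le\beta$, $\alpha\le\beta$, $\beta\bullet\beta\le\beta$; (5) for any map $f:X\to Y$ and $\beta:Y\to\mathcal{CM}(\Sigma_\tau\times Y)$, $f^\sharp\bullet\alpha\le\beta\bullet f^\sharp\Rightarrow f^\sharp\bullet\alpha^\star\le\beta^\star\bullet f^\sharp$, and likewise with $\ge$. *)

theory Defs
  imports Complex_Main "HOL-Library.FuncSet" "HOL-Library.Function_Algebras" "HOL-Library.Set_Algebras"
begin

(* Monads are presented as Kleisli triples. Objects are the subsets of an arbitrary type 'u rather
   than types, so that the empty set is an object and objects can be quantified over.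
   Kleisli maps are extensional functions, hence equality of maps is equality on the domain. *)

locale kleisli_triple =
  fixes T :: "'u set \<Rightarrow> 't set"
    and unit :: "'u set \<Rightarrow> 'u \<Rightarrow> 't"
    and ext :: "'u set \<Rightarrow> 'u set \<Rightarrow> ('u \<Rightarrow> 't) \<Rightarrow> 't \<Rightarrow> 't"
  assumes unit_in: "x \<in> X \<Longrightarrow> unit X x \<in> T X"
    and ext_in: "f \<in> X \<rightarrow>\<^sub>E T Y \<Longrightarrow> t \<in> T X \<Longrightarrow> ext X Y f t \<in> T Y"
    and ext_unit: "t \<in> T X \<Longrightarrow> ext X X (\<lambda>x\<in>X. unit X x) t = t"
    and ext_apply_unit: "f \<in> X \<rightarrow>\<^sub>E T Y \<Longrightarrow> x \<in> X \<Longrightarrow> ext X Y f (unit X x) = f x"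
    and ext_ext: "f \<in> X \<rightarrow>\<^sub>E T Y \<Longrightarrow> g \<in> Y \<rightarrow>\<^sub>E T Z \<Longrightarrow> t \<in> T X \<Longrightarrow>
      ext Y Z g (ext X Y f t) = ext X Z (\<lambda>x\<in>X. ext Y Z g (f x)) t"
begin

definition hom :: "'u set \<Rightarrow> 'u set \<Rightarrow> ('u \<Rightarrow> 't) set" where
  "hom X Y = X \<rightarrow>\<^sub>E T Y"

definition kid :: "'u set \<Rightarrow> 'u \<Rightarrow> 't" where
  "kid X = (\<lambda>x\<in>X. unit X x)"

definition kcomp :: "'u set \<Rightarrow> 'u set \<Rightarrow> 'u set \<Rightarrow> ('u \<Rightarrow> 't) \<Rightarrow> ('u \<Rightarrow> 't) \<Rightarrow> 'u \<Rightarrow> 't" where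
  "kcomp X Y Z g f = (\<lambda>x\<in>X. ext Y Z g (f x))"

definition sharp :: "'u set \<Rightarrow> 'u set \<Rightarrow> ('u \<Rightarrow> 'u) \<Rightarrow> 'u \<Rightarrow> 't" where
  "sharp X Y f = (\<lambda>x\<in>X. unit Y (f x))"

end

locale ordered_saturation_monad = kleisli_triple T unit ext
  for T :: "'u set \<Rightarrow> 't set"
    and unit :: "'u set \<Rightarrow> 'u \<Rightarrow> 't"
    and ext :: "'u set \<Rightarrow> 'u set \<Rightarrow> ('u \<Rightarrow> 't) \<Rightarrow> 't \<Rightarrow> 't" +
  fixes le :: "'u set \<Rightarrow> 'u set \<Rightarrow> ('u \<Rightarrow> 't) \<Rightarrow> ('u \<Rightarrow> 't) \<Rightarrow> bool"
  assumes le_refl: "reflp_on (hom X Y) (le X Y)"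
    and le_antisym: "antisymp_on (hom X Y) (le X Y)"
    and le_trans: "transp_on (hom X Y) (le X Y)"
    and kcomp_mono: "f \<in> hom X Y \<Longrightarrow> f' \<in> hom X Y \<Longrightarrow> g \<in> hom Y Z \<Longrightarrow> g' \<in> hom Y Z \<Longrightarrow>
      le X Y f f' \<Longrightarrow> le Y Z g g' \<Longrightarrow> le X Z (kcomp X Y Z g f) (kcomp X Y Z g' f')"
    and saturation: "\<exists>star :: 'u set \<Rightarrow> ('u \<Rightarrow> 't) \<Rightarrow> 'u \<Rightarrow> 't.
      (\<forall>X. \<forall>\<alpha> \<in> hom X X.
         star X \<alpha> \<in> hom X X \<and>
         le X X (kid X) (star X \<alpha>) \<and>
         le X X \<alpha> (star X \<alpha>) \<and>
         le X X (kcomp X X X (star X \<alpha>) (star X \<alpha>)) (star X \<alpha>) \<and>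
         (\<forall>\<beta> \<in> hom X X. le X X (kid X) \<beta> \<longrightarrow> le X X \<alpha> \<beta> \<longrightarrow> le X X (kcomp X X X \<beta> \<beta>) \<beta> \<longrightarrow>
            le X X (star X \<alpha>) \<beta>)) \<and>
      (\<forall>X Y. \<forall>\<alpha> \<in> hom X X. \<forall>\<beta> \<in> hom Y Y. \<forall>f \<in> X \<rightarrow> Y.
         (le X Y (kcomp X X Y (sharp X Y f) \<alpha>) (kcomp X Y Y \<beta> (sharp X Y f)) \<longrightarrow>
          le X Y (kcomp X X Y (sharp X Y f) (star X \<alpha>)) (kcomp X Y Y (star Y \<beta>) (sharp X Y f))) \<and>
         (le X Y (kcomp X Y Y \<beta> (sharp X Y f)) (kcomp X X Y (sharp X Y f) \<alpha>) \<longrightarrow>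
          le X Y (kcomp X Y Y (star Y \<beta>) (sharp X Y f)) (kcomp X X Y (sharp X Y f) (star X \<alpha>))))"

definition supp :: "('a \<Rightarrow> real) \<Rightarrow> 'a set" where
  "supp \<phi> = {x. \<phi> x \<noteq> 0}"

definition \<M> :: "'a set \<Rightarrow> ('a \<Rightarrow> real) set" where
  "\<M> X = {\<phi>. (\<forall>x. 0 \<le> \<phi> x) \<and> finite (supp \<phi>) \<and> supp \<phi> \<subseteq> X}"

definition scale :: "real \<Rightarrow> ('a \<Rightarrow> real) \<Rightarrow> 'a \<Rightarrow> real" where
  "scale a \<phi> = (\<lambda>x. a * \<phi> x)"

definition single :: "'a \<Rightarrow> 'a \<Rightarrow> real" where
  "single x = (\<lambda>y. if y = x then 1 else 0)"

definition convex_set :: "('a \<Rightarrow> real) set \<Rightarrow> bool" where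
  "convex_set U \<longleftrightarrow> (\<forall>(n::nat) a \<phi>.
     (\<forall>i<n. 0 \<le> a i \<and> \<phi> i \<in> U) \<longrightarrow> (\<Sum>i<n. a i) = 1 \<longrightarrow> (\<Sum>i<n. scale (a i) (\<phi> i)) \<in> U)"

definition \<C>\<M> :: "'a set \<Rightarrow> ('a \<Rightarrow> real) set set" where
  "\<C>\<M> X = {U. U \<noteq> {} \<and> U \<subseteq> \<M> X \<and> convex_set U}"

(* The silent label tau is None. *)
definition labels :: "'s set \<Rightarrow> 's option set" where
  "labels \<Sigma> = insert None (Some ` \<Sigma>)"

definition \<rho> :: "'s option \<Rightarrow> ('s option \<times> 'z \<Rightarrow> real) \<Rightarrow> 's option \<times> 'z \<Rightarrow> real" where
  "\<rho> \<sigma> \<psi> = (if \<sigma> = None then \<psi> else (\<lambda>(\<sigma>', z). if \<sigma>' = \<sigma> then \<psi> (None, z) else 0))"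

definition cm_unit :: "'x \<Rightarrow> ('s option \<times> 'x \<Rightarrow> real) set" where
  "cm_unit x = {single (None, x)}"

(* The sum is the Minkowski sum of sets (Set_Algebras) of functions (Function_Algebras);
   the empty sum is {0}. *)
definition cm_ext :: "('y \<Rightarrow> ('s option \<times> 'z \<Rightarrow> real) set) \<Rightarrow>
    ('s option \<times> 'y \<Rightarrow> real) set \<Rightarrow> ('s option \<times> 'z \<Rightarrow> real) set" where
  "cm_ext g U = (\<Union>\<phi>\<in>U. \<Sum>(\<sigma>, y)\<in>supp \<phi>. {scale (\<phi> (\<sigma>, y)) (\<rho> \<sigma> \<psi>) | \<psi>. \<psi> \<in> g y})"

end

theory Submission
  imports Defs
begin

text \<open>
  An element of an extension is obtained from some \<open>\<phi>\<close> by choosing a continuation at each point of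
  its support. In the associativity law, one side chooses a single continuation per intermediate
  point while the other chooses one for every way of reaching it; averaging the latter stays inside
  the convex value sets, so the two sides agree.

  The saturation \<open>\<alpha>\<^sup>\<star>\<close> is the pointwise intersection of all \<open>\<beta>\<close> with \<open>1 \<le> \<beta>\<close>, \<open>\<alpha> \<le> \<beta>\<close>
  and \<open>\<beta> \<bullet> \<beta> \<le> \<beta>\<close>. For condition (5) no description of its elements is needed: the largest
  \<open>\<gamma>\<close> with \<open>f\<^sup>\<sharp> \<bullet> \<gamma> \<le> \<beta>\<^sup>\<star> \<bullet> f\<^sup>\<sharp>\<close> exists, satisfies these three inequalities relative to
  \<open>\<alpha>\<close>, and hence lies above \<open>\<alpha>\<^sup>\<star>\<close>. Dually, one uses the largest \<open>\<delta>\<close> with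
  \<open>\<delta> \<bullet> f\<^sup>\<sharp> \<le> f\<^sup>\<sharp> \<bullet> \<alpha>\<^sup>\<star>\<close>.
\<close>

section \<open>Combining a finitely supported function with a choice of continuations\<close>

lemma sum_apply: "(\<Sum>i\<in>I. F i) x = (\<Sum>i\<in>I. F i x)"
  for F :: "'i \<Rightarrow> 'a \<Rightarrow> 'b::comm_monoid_add"
  by (induction I rule: infinite_finite_induct) auto

text \<open>One element of the Minkowski sum over \<open>supp \<phi>\<close>. The continuation
  \<open>k\<close> takes the label as well as the state, because the summands for two labels at the
  same \<open>y\<close> are chosen independently from \<open>g y\<close>.\<close>

definition kbind :: "('s option \<times> 'y \<Rightarrow> real) \<Rightarrow> ('s option \<times> 'y \<Rightarrow> 's option \<times> 'z \<Rightarrow> real) \<Rightarrow>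
    's option \<times> 'z \<Rightarrow> real" where
  "kbind \<phi> k = (\<Sum>p\<in>supp \<phi>. scale (\<phi> p) (\<rho> (fst p) (k p)))"

lemma kbind_apply: "kbind \<phi> k q = (\<Sum>p\<in>supp \<phi>. \<phi> p * \<rho> (fst p) (k p) q)"
  by (simp add: kbind_def sum_apply scale_def)

text \<open>Points outside the support contribute zero, so functions with different supports can be
  summed over one common finite set.\<close>

lemma kbind_apply_superset:
  assumes "finite A" "supp \<phi> \<subseteq> A"
  shows "kbind \<phi> k q = (\<Sum>p\<in>A. \<phi> p * \<rho> (fst p) (k p) q)"
  unfolding kbind_apply using assms by (intro sum.mono_neutral_left) (auto simp: supp_def)

lemma kbind_cong:
  assumes "\<And>p. p \<in> supp \<phi> \<Longrightarrow> k p = k' p"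
  shows "kbind \<phi> k = kbind \<phi> k'"
  using assms by (simp add: kbind_def)

lemma rho_apply:
  "\<rho> \<sigma> \<psi> q = (if \<sigma> = None then \<psi> q else if fst q = \<sigma> then \<psi> (None, snd q) else 0)"
  by (cases q) (simp add: \<rho>_def)

lemma rho_None [simp]: "\<rho> None \<psi> = \<psi>"
  by (simp add: \<rho>_def)

lemma rho_single: "\<rho> \<sigma> (single (None, x)) = single (\<sigma>, x)"
  by (rule ext) (auto simp: rho_apply single_def)

text \<open>Linearity of \<open>\<rho> \<sigma>\<close>: each of its values is either 0 or the value
  of its argument at a point that does not depend on that argument.\<close>

lemma rho_sum: "\<rho> \<sigma> (\<Sum>i\<in>I. scale (a i) (\<psi> i)) q = (\<Sum>i\<in>I. a i * \<rho> \<sigma> (\<psi> i) q)"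
  by (cases \<sigma>; cases "fst q = \<sigma>") (simp_all add: rho_apply sum_apply scale_def)

lemma rho_in_M:
  assumes "\<psi> \<in> \<M> (labels \<Sigma> \<times> Z)" "\<sigma> \<in> labels \<Sigma>"
  shows "\<rho> \<sigma> \<psi> \<in> \<M> (labels \<Sigma> \<times> Z)"
proof (cases "\<sigma> = None")
  case False
  have "supp (\<rho> \<sigma> \<psi>) \<subseteq> {\<sigma>} \<times> snd ` supp \<psi>"
    using False by (force simp: supp_def rho_apply split: if_splits)
  moreover have "finite ({\<sigma>} \<times> snd ` supp \<psi>)" "{\<sigma>} \<times> snd ` supp \<psi> \<subseteq> labels \<Sigma> \<times> Z"
    using assms by (auto simp: \<M>_def)
  ultimately show ?thesis
    using assms(1) finite_subset[of "supp (\<rho> \<sigma> \<psi>)"] by (auto simp: \<M>_def rho_apply)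
qed (use assms in auto)

lemma supp_sum_scale: "supp (\<Sum>i\<in>I. scale (a i) (\<phi> i)) \<subseteq> (\<Union>i\<in>I. supp (\<phi> i))"
proof
  fix x assume "x \<in> supp (\<Sum>i\<in>I. scale (a i) (\<phi> i))"
  then obtain i where "i \<in> I" "a i * \<phi> i x \<noteq> 0"
    using sum.not_neutral_contains_not_neutral[of "\<lambda>i. a i * \<phi> i x" I]
    by (auto simp: supp_def sum_apply scale_def)
  then show "x \<in> (\<Union>i\<in>I. supp (\<phi> i))"
    by (auto simp: supp_def)
qed

lemma sum_scale_in_M:
  assumes "finite I" "\<And>i. i \<in> I \<Longrightarrow> 0 \<le> a i" "\<And>i. i \<in> I \<Longrightarrow> \<phi> i \<in> \<M> A"
  shows "(\<Sum>i\<in>I. scale (a i) (\<phi> i)) \<in> \<M> A"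
proof -
  have "finite (\<Union>i\<in>I. supp (\<phi> i))" "(\<Union>i\<in>I. supp (\<phi> i)) \<subseteq> A"
    using assms by (auto simp: \<M>_def)
  moreover have "0 \<le> (\<Sum>i\<in>I. scale (a i) (\<phi> i)) x" for x
    using assms by (auto simp: \<M>_def sum_apply scale_def intro!: sum_nonneg mult_nonneg_nonneg)
  ultimately show ?thesis
    using supp_sum_scale[of a \<phi> I] unfolding \<M>_def by (blast intro: finite_subset)
qed

lemma supp_single: "supp (single x) = {x}"
  by (auto simp: supp_def single_def)

lemma single_in_M: "x \<in> A \<Longrightarrow> single x \<in> \<M> A"
  by (auto simp: \<M>_def supp_def single_def)

lemma kbind_in_M:
  assumes "\<phi> \<in> \<M> (labels \<Sigma> \<times> Y)" "\<And>p. p \<in> supp \<phi> \<Longrightarrow> k p \<in> \<M> (labels \<Sigma> \<times> Z)"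
  shows "kbind \<phi> k \<in> \<M> (labels \<Sigma> \<times> Z)"
  unfolding kbind_def
  using assms by (intro sum_scale_in_M rho_in_M) (auto simp: \<M>_def)

text \<open>Linearity in the first argument, for one \<open>k\<close> shared by all summands. The
  support of the combination may be smaller than the union of the supports, so everything is summed
  over that union.\<close>

lemma kbind_sum_scale:
  assumes "finite I" "\<And>i. i \<in> I \<Longrightarrow> finite (supp (\<phi> i))"
  shows "kbind (\<Sum>i\<in>I. scale (a i) (\<phi> i)) k = (\<Sum>i\<in>I. scale (a i) (kbind (\<phi> i) k))"
proof
  fix q
  define A where "A = (\<Union>i\<in>I. supp (\<phi> i))"
  have A: "finite A" "\<And>i. i \<in> I \<Longrightarrow> supp (\<phi> i) \<subseteq> A"
    using assms by (auto simp: A_def)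
  have "kbind (\<Sum>i\<in>I. scale (a i) (\<phi> i)) k q
      = (\<Sum>p\<in>A. (\<Sum>i\<in>I. scale (a i) (\<phi> i)) p * \<rho> (fst p) (k p) q)"
    using A(1) supp_sum_scale[of a \<phi> I] by (intro kbind_apply_superset) (simp_all add: A_def)
  also have "\<dots> = (\<Sum>i\<in>I. \<Sum>p\<in>A. a i * (\<phi> i p * \<rho> (fst p) (k p) q))"
    by (subst sum.swap) (simp add: sum_apply scale_def sum_distrib_right mult.assoc)
  also have "\<dots> = (\<Sum>i\<in>I. a i * kbind (\<phi> i) k q)"
    using A by (simp add: kbind_apply_superset sum_distrib_left)
  finally show "kbind (\<Sum>i\<in>I. scale (a i) (\<phi> i)) k q = (\<Sum>i\<in>I. scale (a i) (kbind (\<phi> i) k)) q"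
    by (simp add: sum_apply scale_def)
qed

text \<open>An enumeration of \<open>I\<close> reduces this to the index sets \<open>{..<n}\<close>
  in \<open>convex_set\<close>, so that any finite set can index a convex combination.\<close>

lemma convex_set_sum:
  assumes "convex_set U" "finite I" "\<And>i. i \<in> I \<Longrightarrow> 0 \<le> a i" "\<And>i. i \<in> I \<Longrightarrow> \<phi> i \<in> U"
    and "sum a I = 1"
  shows "(\<Sum>i\<in>I. scale (a i) (\<phi> i)) \<in> U"
proof -
  obtain h where h: "bij_betw h {..<card I} I"
    using ex_bij_betw_nat_finite[OF assms(2)] by (auto simp: atLeast0LessThan)
  have "(\<Sum>j<card I. a (h j)) = 1"
    using sum.reindex_bij_betw[OF h, of a] assms(5) by simp
  moreover have "\<forall>j<card I. 0 \<le> a (h j) \<and> \<phi> (h j) \<in> U"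
    using bij_betwE[OF h] assms by blast
  ultimately have "(\<Sum>j<card I. scale (a (h j)) (\<phi> (h j))) \<in> U"
    using assms(1)[unfolded convex_set_def, rule_format, of "card I" "\<lambda>j. a (h j)" "\<lambda>j. \<phi> (h j)"]
    by simp
  then show ?thesis
    using sum.reindex_bij_betw[OF h, of "\<lambda>i. scale (a i) (\<phi> i)"] by simp
qed

text \<open>The weights need not add up to 1: at each point the continuations are averaged with weights
  normalised by the total mass there. This gives both the convexity of extensions and the hard
  inclusion of the associativity law.\<close>

lemma kbind_mixture:
  assumes I: "finite I" and a: "\<And>i. i \<in> I \<Longrightarrow> 0 \<le> a i" and \<phi>: "\<And>i. i \<in> I \<Longrightarrow> \<phi> i \<in> \<M> A"
    and K: "\<And>p. p \<in> A \<Longrightarrow> convex_set (K p)"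
    and k: "\<And>i p. i \<in> I \<Longrightarrow> p \<in> supp (\<phi> i) \<Longrightarrow> k i p \<in> K p"
  defines "\<Phi> \<equiv> \<Sum>i\<in>I. scale (a i) (\<phi> i)"
  obtains k' where "\<And>p. p \<in> supp \<Phi> \<Longrightarrow> k' p \<in> K p"
    and "kbind \<Phi> k' = (\<Sum>i\<in>I. scale (a i) (kbind (\<phi> i) (k i)))"
proof
  \<comment> \<open>The average at \<open>p\<close> runs only over the \<open>i\<close> that reach
    \<open>p\<close>, since \<open>k i p\<close> is known to lie in \<open>K p\<close> only for
    these.\<close>
  define J where "J p = {i \<in> I. \<phi> i p \<noteq> 0}" for p
  define w where "w p i = a i * \<phi> i p / \<Phi> p" for p i
  define k' where "k' p = (\<Sum>i\<in>J p. scale (w p i) (k i p))" for p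
  have J: "finite (J p)" for p
    using I by (simp add: J_def)
  have \<Phi>: "\<Phi> p = (\<Sum>i\<in>I. a i * \<phi> i p)" for p
    by (simp add: \<Phi>_def sum_apply scale_def)
  have \<Phi>_J: "\<Phi> p = (\<Sum>i\<in>J p. a i * \<phi> i p)" for p
    unfolding \<Phi> using I by (intro sum.mono_neutral_right) (auto simp: J_def)
  have nonneg: "0 \<le> \<phi> i p" if "i \<in> I" for i p
    using \<phi>[OF that] unfolding \<M>_def by blast
  have \<Phi>_nonneg: "0 \<le> \<Phi> p" for p
    unfolding \<Phi> by (intro sum_nonneg mult_nonneg_nonneg a nonneg)
  have \<Phi>_zero: "a i * \<phi> i p = 0" if "\<Phi> p = 0" "i \<in> I" for i p
    using that I a nonneg sum_nonneg_eq_0_iff[of I "\<lambda>i. a i * \<phi> i p"] by (simp add: \<Phi>)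
  have "\<Phi> \<in> \<M> A"
    unfolding \<Phi>_def using I a \<phi> by (rule sum_scale_in_M)
  then have supp_\<Phi>: "supp \<Phi> \<subseteq> A"
    by (simp add: \<M>_def)
  show "k' p \<in> K p" if "p \<in> supp \<Phi>" for p
    unfolding k'_def
  proof (rule convex_set_sum[OF K J])
    show "p \<in> A"
      using that supp_\<Phi> by blast
    show "0 \<le> w p i" if "i \<in> J p" for i
      using that a nonneg \<Phi>_nonneg by (auto simp: w_def J_def)
    show "k i p \<in> K p" if "i \<in> J p" for i
      using that k by (auto simp: J_def supp_def)
    show "sum (w p) (J p) = 1"
      using that unfolding w_def by (simp add: sum_divide_distrib[symmetric] \<Phi>_J[symmetric] supp_def)
  qed
  define B where "B = (\<Union>i\<in>I. supp (\<phi> i))"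
  have B: "finite B" "\<And>i. i \<in> I \<Longrightarrow> supp (\<phi> i) \<subseteq> B"
    using I \<phi> by (auto simp: B_def \<M>_def)
  have supp_B: "supp \<Phi> \<subseteq> B"
    using supp_sum_scale[of a \<phi> I] by (simp add: \<Phi>_def B_def)
  \<comment> \<open>Multiplying by \<open>\<Phi> p\<close> cancels the denominator in
    \<open>w\<close>. If \<open>\<Phi> p = 0\<close>, then all \<open>a i * \<phi> i p\<close>
    vanish by nonnegativity, and both sides are 0.\<close>
  have step: "\<Phi> p * \<rho> \<sigma> (k' p) q = (\<Sum>i\<in>I. a i * (\<phi> i p * \<rho> \<sigma> (k i p) q))" for p \<sigma> q
  proof -
    have "\<Phi> p * \<rho> \<sigma> (k' p) q = (\<Sum>i\<in>J p. \<Phi> p * (w p i * \<rho> \<sigma> (k i p) q))"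
      by (simp add: k'_def rho_sum sum_distrib_left)
    also have "\<dots> = (\<Sum>i\<in>J p. a i * (\<phi> i p * \<rho> \<sigma> (k i p) q))"
      using \<Phi>_zero[of p] by (intro sum.cong) (auto simp: w_def J_def)
    also have "\<dots> = (\<Sum>i\<in>I. a i * (\<phi> i p * \<rho> \<sigma> (k i p) q))"
      using I by (intro sum.mono_neutral_left) (auto simp: J_def)
    finally show ?thesis .
  qed
  show "kbind \<Phi> k' = (\<Sum>i\<in>I. scale (a i) (kbind (\<phi> i) (k i)))"
  proof
    fix q
    have "kbind \<Phi> k' q = (\<Sum>p\<in>B. \<Sum>i\<in>I. a i * (\<phi> i p * \<rho> (fst p) (k i p) q))"
      using B supp_B by (simp add: kbind_apply_superset[of B] step)
    also have "\<dots> = (\<Sum>i\<in>I. a i * kbind (\<phi> i) (k i) q)"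
      using B by (subst sum.swap) (simp add: kbind_apply_superset[of B] sum_distrib_left)
    finally show "kbind \<Phi> k' q = (\<Sum>i\<in>I. scale (a i) (kbind (\<phi> i) (k i))) q"
      by (simp add: sum_apply scale_def)
  qed
qed

text \<open>A visible label erases everything except the silent part, hence only the silent part of
  \<open>\<psi>\<close> and its continuations survive.\<close>

lemma rho_Some_kbind:
  assumes "finite (supp \<psi>)"
  shows "\<rho> (Some s) (kbind \<psi> k) = kbind (\<rho> (Some s) \<psi>) (\<lambda>(_, z). k (None, z))"
proof
  fix q
  let ?S = "{p \<in> supp \<psi>. fst p = None}"
  let ?h = "\<lambda>p. (Some s, snd p)"
  \<comment> \<open>Only the silent points of \<open>\<psi>\<close> survive, relabelled by
    \<open>s\<close>; the relabelling is injective on them since they share the label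
    \<open>None\<close>.\<close>
  have supp: "supp (\<rho> (Some s) \<psi>) = ?h ` ?S"
    by (force simp: supp_def rho_apply image_iff split: if_splits)
  have inj: "inj_on ?h ?S"
    by (auto simp: inj_on_def)
  have "kbind (\<rho> (Some s) \<psi>) (\<lambda>(_, z). k (None, z)) q
      = (\<Sum>p\<in>?S. \<psi> p * \<rho> (Some s) (k p) q)"
    unfolding kbind_apply supp sum.reindex[OF inj]
    by (intro sum.cong) (auto simp: rho_apply)
  \<comment> \<open>For \<open>p\<close> with a visible label, \<open>\<rho> (fst p) (k p)\<close>
    vanishes at every silent point, and the outer \<open>\<rho> (Some s)\<close> reads only silent
    points.\<close>
  also have "\<dots> = (\<Sum>p\<in>supp \<psi>. \<psi> p * \<rho> (Some s) (\<rho> (fst p) (k p)) q)"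
    using assms by (intro sum.mono_neutral_cong_left) (auto simp: rho_apply)
  also have "\<dots> = \<rho> (Some s) (kbind \<psi> k) q"
    by (simp add: kbind_def rho_sum)
  finally show "\<rho> (Some s) (kbind \<psi> k) q
      = kbind (\<rho> (Some s) \<psi>) (\<lambda>(_, z). k (None, z)) q" ..
qed

section \<open>Membership, monotonicity and convexity of extensions\<close>

text \<open>A Minkowski sum over a finite index set consists of the sums of one chosen element per
  index; the bound \<open>\<M> A\<close> supplies finite supports.\<close>

lemma cm_ext_eq:
  assumes "U \<subseteq> \<M> A"
  shows "cm_ext g U = {kbind \<phi> k | \<phi> k. \<phi> \<in> U \<and> (\<forall>p\<in>supp \<phi>. k p \<in> g (snd p))}"
proof -
  have "(\<Sum>(\<sigma>, y)\<in>supp \<phi>. {scale (\<phi> (\<sigma>, y)) (\<rho> \<sigma> \<psi>) | \<psi>. \<psi> \<in> g y})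
      = {kbind \<phi> k | k. \<forall>p\<in>supp \<phi>. k p \<in> g (snd p)}" (is "?L = ?R") if "\<phi> \<in> U" for \<phi>
  proof -
    have "finite (supp \<phi>)"
      using that assms by (auto simp: \<M>_def)
    then have L: "?L = {sum s (supp \<phi>) | s. \<forall>p\<in>supp \<phi>.
        s p \<in> {scale (\<phi> p) (\<rho> (fst p) \<psi>) | \<psi>. \<psi> \<in> g (snd p)}}"
      by (subst set_sum_alt) (auto simp: case_prod_beta)
    show ?thesis
    proof (intro set_eqI iffI)
      fix \<chi> assume "\<chi> \<in> ?L"
      then obtain s where s: "\<chi> = sum s (supp \<phi>)"
        "\<forall>p\<in>supp \<phi>. \<exists>\<psi>. s p = scale (\<phi> p) (\<rho> (fst p) \<psi>) \<and> \<psi> \<in> g (snd p)"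
        unfolding L by blast
      from bchoice[OF s(2)] obtain k where
        k: "\<forall>p\<in>supp \<phi>. s p = scale (\<phi> p) (\<rho> (fst p) (k p)) \<and> k p \<in> g (snd p)" ..
      then have "\<chi> = kbind \<phi> k"
        unfolding s(1) kbind_def by (intro sum.cong) auto
      with k show "\<chi> \<in> ?R" by blast
    next
      fix \<chi> assume "\<chi> \<in> ?R"
      then show "\<chi> \<in> ?L"
        unfolding L kbind_def by blast
    qed
  qed
  then show ?thesis
    unfolding cm_ext_def by blast
qed

lemma cm_extE:
  assumes "\<chi> \<in> cm_ext g U" "U \<subseteq> \<M> A"
  obtains \<phi> k where "\<phi> \<in> U" "\<And>p. p \<in> supp \<phi> \<Longrightarrow> k p \<in> g (snd p)" "\<chi> = kbind \<phi> k"
  using assms(1) unfolding cm_ext_eq[OF assms(2)] by blast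

lemma cm_extI:
  assumes "U \<subseteq> \<M> A" "\<phi> \<in> U" "\<And>p. p \<in> supp \<phi> \<Longrightarrow> k p \<in> g (snd p)"
  shows "kbind \<phi> k \<in> cm_ext g U"
  using assms unfolding cm_ext_eq[OF assms(1)] by blast

text \<open>Comparing \<open>g\<close> and \<open>h\<close> on \<open>Y\<close> is enough, since
  elements of \<open>V\<close> are supported in \<open>L \<times> Y\<close> and no other state is
  ever continued.\<close>

lemma cm_ext_mono:
  assumes "U \<subseteq> V" "V \<subseteq> \<M> (L \<times> Y)" "\<And>y. y \<in> Y \<Longrightarrow> g y \<subseteq> h y"
  shows "cm_ext g U \<subseteq> cm_ext h V"
proof
  fix \<chi> assume "\<chi> \<in> cm_ext g U"
  then obtain \<phi> k where *: "\<phi> \<in> U" "\<And>p. p \<in> supp \<phi> \<Longrightarrow> k p \<in> g (snd p)" "\<chi> = kbind \<phi> k"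
    using cm_extE[of \<chi> g U "L \<times> Y"] assms by blast
  moreover from * have "\<phi> \<in> V" "supp \<phi> \<subseteq> L \<times> Y"
    using assms by (auto simp: \<M>_def)
  then have "k p \<in> h (snd p)" if "p \<in> supp \<phi>" for p
    using that *(2)[OF that] assms(3)[of "snd p"] mem_Times_iff[of p L Y] by blast
  ultimately show "\<chi> \<in> cm_ext h V"
    using cm_extI[OF assms(2) \<open>\<phi> \<in> V\<close>] by blast
qed

lemma cm_ext_cong:
  assumes "U \<subseteq> \<M> (L \<times> Y)" "\<And>y. y \<in> Y \<Longrightarrow> g y = h y"
  shows "cm_ext g U = cm_ext h U"
  using cm_ext_mono[of U U L Y g h] cm_ext_mono[of U U L Y h g] assms by blast

lemma cm_unit_in_CM: "x \<in> X \<Longrightarrow> cm_unit x \<in> \<C>\<M> (labels \<Sigma> \<times> X)"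
proof -
  assume "x \<in> X"
  then have "single (None, x) \<in> \<M> (labels \<Sigma> \<times> X)"
    by (intro single_in_M) (simp add: labels_def)
  moreover have "(\<Sum>i<n. scale (a i) (single (None, x))) = single (None, x)"
    if "(\<Sum>i<n. a i) = 1" for n :: nat and a
    using that by (intro ext) (simp add: sum_apply scale_def sum_distrib_right[symmetric])
  ultimately show ?thesis
    by (auto simp: \<C>\<M>_def cm_unit_def convex_set_def)
qed

text \<open>Nonemptiness: all values of \<open>g\<close> at the states concerned are nonempty, so a
  continuation can be chosen at each support point. Convexity: by \<open>kbind_mixture\<close>, a
  combination of elements \<open>kbind (\<phi> i) (k i)\<close> is the combination of the
  \<open>\<phi> i\<close> followed by averaged continuations.\<close>

lemma cm_ext_in_CM:
  assumes g: "\<And>y. y \<in> Y \<Longrightarrow> g y \<in> \<C>\<M> (labels \<Sigma> \<times> Z)" and U: "U \<in> \<C>\<M> (labels \<Sigma> \<times> Y)"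
  shows "cm_ext g U \<in> \<C>\<M> (labels \<Sigma> \<times> Z)"
proof -
  let ?A = "labels \<Sigma> \<times> Y"
  have U': "U \<noteq> {}" "U \<subseteq> \<M> ?A" "convex_set U"
    using U by (auto simp: \<C>\<M>_def)
  have g': "g (snd p) \<noteq> {}" "g (snd p) \<subseteq> \<M> (labels \<Sigma> \<times> Z)" "convex_set (g (snd p))"
    if "p \<in> ?A" for p
    using g[of "snd p"] that by (auto simp: \<C>\<M>_def)
  have supp: "supp \<phi> \<subseteq> ?A" if "\<phi> \<in> U" for \<phi>
    using that U' by (auto simp: \<M>_def)
  obtain \<phi> where "\<phi> \<in> U"
    using U' by blast
  moreover have "(SOME \<psi>. \<psi> \<in> g (snd p)) \<in> g (snd p)" if "p \<in> supp \<phi>" for p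
    using g'(1)[of p] supp[OF \<open>\<phi> \<in> U\<close>] that some_in_eq by blast
  ultimately have "cm_ext g U \<noteq> {}"
    using cm_extI[OF U'(2), of \<phi> "\<lambda>p. SOME \<psi>. \<psi> \<in> g (snd p)" g] by blast
  moreover have "cm_ext g U \<subseteq> \<M> (labels \<Sigma> \<times> Z)"
  proof
    fix \<chi> assume "\<chi> \<in> cm_ext g U"
    then obtain \<phi> k where *: "\<phi> \<in> U" "\<And>p. p \<in> supp \<phi> \<Longrightarrow> k p \<in> g (snd p)" "\<chi> = kbind \<phi> k"
      using cm_extE[OF _ U'(2)] by blast
    show "\<chi> \<in> \<M> (labels \<Sigma> \<times> Z)"
      unfolding *(3) using * U' g'(2) supp[OF *(1)] by (intro kbind_in_M[of _ _ Y]) blast+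
  qed
  moreover have "convex_set (cm_ext g U)"
    unfolding convex_set_def
  proof (intro allI impI)
    fix n :: nat and a :: "nat \<Rightarrow> real" and \<chi>
    assume *: "\<forall>i<n. 0 \<le> a i \<and> \<chi> i \<in> cm_ext g U" and one: "(\<Sum>i<n. a i) = 1"
    have "\<forall>i<n. \<exists>\<phi> k. \<phi> \<in> U \<and> (\<forall>p\<in>supp \<phi>. k p \<in> g (snd p)) \<and> \<chi> i = kbind \<phi> k"
      using * cm_extE[OF _ U'(2)] by metis
    then obtain \<phi> k where k: "\<And>i. i < n \<Longrightarrow> \<phi> i \<in> U"
      "\<And>i p. i < n \<Longrightarrow> p \<in> supp (\<phi> i) \<Longrightarrow> k i p \<in> g (snd p)"
      "\<And>i. i < n \<Longrightarrow> \<chi> i = kbind (\<phi> i) (k i)"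
      by metis
    obtain k' where k': "\<And>p. p \<in> supp (\<Sum>i<n. scale (a i) (\<phi> i)) \<Longrightarrow> k' p \<in> g (snd p)"
      "kbind (\<Sum>i<n. scale (a i) (\<phi> i)) k' = (\<Sum>i<n. scale (a i) (kbind (\<phi> i) (k i)))"
    proof (rule kbind_mixture[of "{..<n}" a \<phi> ?A "\<lambda>p. g (snd p)" k])
      show "\<phi> i \<in> \<M> ?A" if "i \<in> {..<n}" for i
        using that k(1) U'(2) by blast
      show "k i p \<in> g (snd p)" if "i \<in> {..<n}" "p \<in> supp (\<phi> i)" for i p
        using that k(2) by blast
      show "0 \<le> a i" if "i \<in> {..<n}" for i
        using that * by blast
    qed (assumption | use g'(3) in blast | simp)+
    have "(\<Sum>i<n. scale (a i) (\<phi> i)) \<in> U"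
      using U'(3) * k one by (simp add: convex_set_def)
    then have "kbind (\<Sum>i<n. scale (a i) (\<phi> i)) k' \<in> cm_ext g U"
      using k' by (intro cm_extI[OF U'(2)])
    then show "(\<Sum>i<n. scale (a i) (\<chi> i)) \<in> cm_ext g U"
      using k k' by simp
  qed
  ultimately show ?thesis
    by (simp add: \<C>\<M>_def)
qed

section \<open>Unit laws, pure maps and associativity\<close>

lemma kbind_single:
  assumes "finite (supp \<phi>)"
  shows "kbind \<phi> (\<lambda>p. single (None, snd p)) = \<phi>"
proof
  fix q
  have "kbind \<phi> (\<lambda>p. single (None, snd p)) q = (\<Sum>p\<in>supp \<phi>. if p = q then \<phi> p else 0)"
    by (auto simp: kbind_apply rho_single intro!: sum.cong) (auto simp: single_def)
  also have "\<dots> = \<phi> q"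
    using assms by (auto simp: sum.delta' supp_def)
  finally show "kbind \<phi> (\<lambda>p. single (None, snd p)) q = \<phi> q" .
qed

text \<open>The action of the functor \<open>\<M>\<close> on the map that applies \<open>f\<close>
  to states and keeps labels, written through \<open>kbind\<close> so that linearity carries
  over.\<close>

definition push :: "('x \<Rightarrow> 'y) \<Rightarrow> ('s option \<times> 'x \<Rightarrow> real) \<Rightarrow> 's option \<times> 'y \<Rightarrow> real" where
  "push f \<phi> = kbind \<phi> (\<lambda>p. single (None, f (snd p)))"

text \<open>Each set of continuations is a singleton, so no choice arises and composing with
  \<open>f\<^sup>\<sharp>\<close> on the left is a direct image.\<close>

lemma cm_ext_sharp:
  assumes "U \<subseteq> \<M> (L \<times> X)"
  shows "cm_ext (\<lambda>x\<in>X. cm_unit (f x)) U = push f ` U"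
proof -
  have "cm_ext (\<lambda>x\<in>X. cm_unit (f x)) U = cm_ext (\<lambda>x. cm_unit (f x)) U"
    using assms by (rule cm_ext_cong) simp
  also have "\<dots> = push f ` U"
  proof (intro equalityI subsetI)
    fix \<chi> assume "\<chi> \<in> cm_ext (\<lambda>x. cm_unit (f x)) U"
    then obtain \<phi> k where *: "\<phi> \<in> U" "\<And>p. p \<in> supp \<phi> \<Longrightarrow> k p \<in> cm_unit (f (snd p))"
      "\<chi> = kbind \<phi> k"
      using cm_extE[OF _ assms] by blast
    then have "\<chi> = push f \<phi>"
      by (auto simp: push_def cm_unit_def intro: kbind_cong)
    with * show "\<chi> \<in> push f ` U" by blast
  next
    fix \<chi> assume "\<chi> \<in> push f ` U"
    then show "\<chi> \<in> cm_ext (\<lambda>x. cm_unit (f x)) U"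
      by (auto simp: push_def cm_unit_def intro!: cm_extI[OF assms])
  qed
  finally show ?thesis .
qed

lemma cm_ext_cm_unit:
  assumes "U \<subseteq> \<M> (L \<times> X)"
  shows "cm_ext (\<lambda>x\<in>X. cm_unit x) U = U"
proof -
  have "push (\<lambda>x. x) \<phi> = \<phi>" if "\<phi> \<in> U" for \<phi>
    using that assms by (auto simp: push_def \<M>_def intro!: kbind_single)
  then show ?thesis
    using cm_ext_sharp[OF assms, of "\<lambda>x. x"] by simp
qed

text \<open>\<open>single (None, x)\<close> has one support point, with weight 1 and the silent
  label, so neither scaling nor \<open>\<rho>\<close> changes the continuation.\<close>

lemma cm_ext_apply_unit: "cm_ext g (cm_unit x) = g x"
  by (simp add: cm_ext_def cm_unit_def supp_single scale_def) (simp add: single_def)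

lemma cm_ext_assoc:
  assumes f: "\<And>x. x \<in> X \<Longrightarrow> f x \<in> \<C>\<M> (labels \<Sigma> \<times> Y)"
    and g: "\<And>y. y \<in> Y \<Longrightarrow> g y \<in> \<C>\<M> (labels \<Sigma> \<times> Z)"
    and U: "U \<in> \<C>\<M> (labels \<Sigma> \<times> X)"
  shows "cm_ext g (cm_ext f U) = cm_ext (\<lambda>x\<in>X. cm_ext g (f x)) U"
proof -
  let ?L = "labels \<Sigma>"
  have U': "U \<subseteq> \<M> (?L \<times> X)"
    using U by (simp add: \<C>\<M>_def)
  have f': "f x \<subseteq> \<M> (?L \<times> Y)" if "x \<in> X" for x
    using f[OF that] by (simp add: \<C>\<M>_def)
  have fU: "cm_ext f U \<subseteq> \<M> (?L \<times> Y)"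
    using cm_ext_in_CM[OF f U] by (simp add: \<C>\<M>_def)
  have supp: "finite (supp \<phi>)" "supp \<phi> \<subseteq> ?L \<times> X" "\<And>p. 0 \<le> \<phi> p" if "\<phi> \<in> U" for \<phi>
    using that U' by (auto simp: \<M>_def)
  have "cm_ext g (cm_ext f U) = cm_ext (\<lambda>x. cm_ext g (f x)) U"
  proof (intro equalityI subsetI)
    fix \<chi> assume "\<chi> \<in> cm_ext g (cm_ext f U)"
    then obtain \<omega> \<theta>0 where \<omega>: "\<omega> \<in> cm_ext f U" and
      \<theta>0: "\<And>q. q \<in> supp \<omega> \<Longrightarrow> \<theta>0 q \<in> g (snd q)" "\<chi> = kbind \<omega> \<theta>0"
      using cm_extE[OF _ fU] by blast
    obtain \<phi> \<psi> where \<phi>: "\<phi> \<in> U" and \<psi>: "\<And>p. p \<in> supp \<phi> \<Longrightarrow> \<psi> p \<in> f (snd p)"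
      and \<omega>_eq: "\<omega> = kbind \<phi> \<psi>"
      using cm_extE[OF \<omega> U'] by blast
    \<comment> \<open>\<open>\<theta>0\<close> is constrained on \<open>supp \<omega>\<close> only,
      while the regrouping below also looks up points \<open>(fst p, z)\<close> outside it, for
      instance when \<open>z\<close> occurs in \<open>\<psi> p\<close> only under a visible label.
      An arbitrary element of \<open>g z\<close> serves there.\<close>
    define \<theta> where "\<theta> q = (if q \<in> supp \<omega> then \<theta>0 q else SOME \<eta>. \<eta> \<in> g (snd q))" for q
    have \<theta>: "\<theta> q \<in> g (snd q)" if "snd q \<in> Y" for q
      using \<theta>0(1) g[OF that] by (auto simp: \<theta>_def \<C>\<M>_def some_in_eq)
    have p: "fst p \<in> ?L" "snd p \<in> X" if "p \<in> supp \<phi>" for p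
      using that supp(2)[OF \<phi>] by auto
    have \<psi>M: "\<psi> p \<in> \<M> (?L \<times> Y)" if "p \<in> supp \<phi>" for p
      using \<psi>[OF that] f'[OF p(2)[OF that]] by blast
    \<comment> \<open>After a visible label \<open>fst p\<close>, a silent point
      \<open>(None, z)\<close> of \<open>\<psi> p\<close> appears in \<open>\<omega>\<close> as
      \<open>(fst p, z)\<close>, so its continuation is looked up there.\<close>
    define \<theta>' where "\<theta>' p q = (if fst p = None then \<theta> q else \<theta> (fst p, snd q))"
      for p :: "'b option \<times> 'a" and q
    have *: "kbind (\<rho> (fst p) (\<psi> p)) \<theta> = \<rho> (fst p) (kbind (\<psi> p) (\<theta>' p))" if "p \<in> supp \<phi>" for p
    proof (cases "fst p")
      case None
      then show ?thesis by (auto simp: \<theta>'_def intro: kbind_cong)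
    next
      case (Some s)
      have "finite (supp (\<psi> p))"
        using \<psi>M[OF that] by (simp add: \<M>_def)
      then show ?thesis
        by (auto simp: Some rho_Some_kbind \<theta>'_def supp_def rho_apply
              intro!: kbind_cong split: if_splits)
    qed
    have "\<chi> = kbind \<omega> \<theta>"
      unfolding \<theta>0(2) by (rule kbind_cong) (simp add: \<theta>_def)
    also have "\<dots> = (\<Sum>p\<in>supp \<phi>. scale (\<phi> p) (kbind (\<rho> (fst p) (\<psi> p)) \<theta>))"
      unfolding \<omega>_eq kbind_def[of \<phi> \<psi>]
      using supp(1)[OF \<phi>] rho_in_M[OF \<psi>M p(1)] by (intro kbind_sum_scale) (auto simp: \<M>_def)
    also have "\<dots> = kbind \<phi> (\<lambda>p. kbind (\<psi> p) (\<theta>' p))"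
      by (simp add: kbind_def[of \<phi>] *)
    also have "\<dots> \<in> cm_ext (\<lambda>x. cm_ext g (f x)) U"
    proof (rule cm_extI[OF U' \<phi>])
      fix p assume "p \<in> supp \<phi>"
      moreover from this have "\<theta>' p q \<in> g (snd q)" if "q \<in> supp (\<psi> p)" for q
        using that \<psi>M[of p] \<theta>[of q] \<theta>[of "(fst p, snd q)"] by (auto simp: \<theta>'_def \<M>_def)
      ultimately show "kbind (\<psi> p) (\<theta>' p) \<in> cm_ext g (f (snd p))"
        using \<psi> by (intro cm_extI[OF f'[OF p(2)]])
    qed
    finally show "\<chi> \<in> cm_ext (\<lambda>x. cm_ext g (f x)) U" .
  next
    fix \<chi> assume "\<chi> \<in> cm_ext (\<lambda>x. cm_ext g (f x)) U"
    then obtain \<phi> k where \<phi>: "\<phi> \<in> U" and k: "\<And>p. p \<in> supp \<phi> \<Longrightarrow> k p \<in> cm_ext g (f (snd p))"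
      and \<chi>: "\<chi> = kbind \<phi> k"
      using cm_extE[OF _ U'] by blast
    have p: "fst p \<in> ?L" "snd p \<in> X" if "p \<in> supp \<phi>" for p
      using that supp(2)[OF \<phi>] by auto
    have "\<forall>p\<in>supp \<phi>. \<exists>\<psi> \<theta>. \<psi> \<in> f (snd p) \<and> (\<forall>q\<in>supp \<psi>. \<theta> q \<in> g (snd q)) \<and> k p = kbind \<psi> \<theta>"
      using cm_extE[OF k f'[OF p(2)]] by metis
    then obtain \<psi> \<theta> where \<psi>: "\<And>p. p \<in> supp \<phi> \<Longrightarrow> \<psi> p \<in> f (snd p)"
      and \<theta>: "\<And>p q. p \<in> supp \<phi> \<Longrightarrow> q \<in> supp (\<psi> p) \<Longrightarrow> \<theta> p q \<in> g (snd q)"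
      and k_eq: "\<And>p. p \<in> supp \<phi> \<Longrightarrow> k p = kbind (\<psi> p) (\<theta> p)"
      by metis
    have \<psi>M: "\<psi> p \<in> \<M> (?L \<times> Y)" if "p \<in> supp \<phi>" for p
      using \<psi>[OF that] f'[OF p(2)[OF that]] by blast
    \<comment> \<open>The reverse relabelling: for visible \<open>fst p\<close>, a point
      \<open>(fst p, z)\<close> of \<open>\<rho> (fst p) (\<psi> p)\<close> stems from
      \<open>(None, z)\<close> in \<open>\<psi> p\<close>.\<close>
    define \<theta>' where "\<theta>' p q = (if fst p = None then \<theta> p q else \<theta> p (None, snd q))" for p q
    have *: "\<rho> (fst p) (k p) = kbind (\<rho> (fst p) (\<psi> p)) (\<theta>' p)" if "p \<in> supp \<phi>" for p
    proof (cases "fst p")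
      case None
      then show ?thesis by (auto simp: k_eq[OF that] \<theta>'_def intro: kbind_cong)
    next
      case (Some s)
      have "finite (supp (\<psi> p))"
        using \<psi>M[OF that] by (simp add: \<M>_def)
      then show ?thesis
        by (auto simp: k_eq[OF that] Some rho_Some_kbind \<theta>'_def intro!: kbind_cong)
    qed
    have \<theta>': "\<theta>' p q \<in> g (snd q)" if "p \<in> supp \<phi>" "q \<in> supp (\<rho> (fst p) (\<psi> p))" for p q
      using that \<theta>[OF that(1), of q] \<theta>[OF that(1), of "(None, snd q)"]
      by (auto simp: \<theta>'_def supp_def rho_apply split: if_splits)
    \<comment> \<open>Several \<open>p\<close> may reach the same \<open>q\<close> with different
      continuations \<open>\<theta>' p q\<close>. Mixing with weights \<open>\<phi> p\<close> merges
      them into a single one in the convex set \<open>g (snd q)\<close>; folding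
      \<open>kbind_def\<close> identifies the mixed function as
      \<open>kbind \<phi> \<psi>\<close>.\<close>
    obtain k' where k': "\<And>q. q \<in> supp (kbind \<phi> \<psi>) \<Longrightarrow> k' q \<in> g (snd q)"
      "kbind (kbind \<phi> \<psi>) k' = (\<Sum>p\<in>supp \<phi>. scale (\<phi> p) (kbind (\<rho> (fst p) (\<psi> p)) (\<theta>' p)))"
    proof (rule kbind_mixture[of "supp \<phi>" \<phi> "\<lambda>p. \<rho> (fst p) (\<psi> p)" "?L \<times> Y" "\<lambda>q. g (snd q)" \<theta>',
          folded kbind_def])
      show "convex_set (g (snd q))" if "q \<in> ?L \<times> Y" for q
        using g[of "snd q"] that by (auto simp: \<C>\<M>_def)
    qed (use supp[OF \<phi>] \<theta>' rho_in_M[OF \<psi>M p(1)] in auto)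
    have "\<chi> = kbind (kbind \<phi> \<psi>) k'"
      unfolding k'(2) \<chi> kbind_def[of \<phi> k] by (simp add: *)
    also have "\<dots> \<in> cm_ext g (cm_ext f U)"
      using k'(1) cm_extI[OF U' \<phi>, of \<psi> f, OF \<psi>] by (intro cm_extI[OF fU])
    finally show "\<chi> \<in> cm_ext g (cm_ext f U)" .
  qed
  also have "\<dots> = cm_ext (\<lambda>x\<in>X. cm_ext g (f x)) U"
    using U' by (rule cm_ext_cong) simp
  finally show ?thesis .
qed

lemma kleisli_triple_CM:
  "kleisli_triple (\<lambda>X :: 'u set. \<C>\<M> (labels \<Sigma> \<times> X)) (\<lambda>X. cm_unit) (\<lambda>X Y. cm_ext)"
proof
  fix X :: "'u set" and x assume "x \<in> X"
  then show "cm_unit x \<in> \<C>\<M> (labels \<Sigma> \<times> X)"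
    by (rule cm_unit_in_CM)
next
  fix X Y :: "'u set" and f t
  assume "f \<in> X \<rightarrow>\<^sub>E \<C>\<M> (labels \<Sigma> \<times> Y)" "t \<in> \<C>\<M> (labels \<Sigma> \<times> X)"
  then show "cm_ext f t \<in> \<C>\<M> (labels \<Sigma> \<times> Y)"
    by (intro cm_ext_in_CM[of X]) auto
next
  fix X :: "'u set" and t assume "t \<in> \<C>\<M> (labels \<Sigma> \<times> X)"
  then show "cm_ext (\<lambda>x\<in>X. cm_unit x) t = t"
    by (intro cm_ext_cm_unit[of _ "labels \<Sigma>"]) (simp add: \<C>\<M>_def)
next
  fix X Y :: "'u set" and f x
  show "cm_ext f (cm_unit x) = f x"
    by (rule cm_ext_apply_unit)
next
  fix X Y Z :: "'u set" and f g t
  assume "f \<in> X \<rightarrow>\<^sub>E \<C>\<M> (labels \<Sigma> \<times> Y)" "g \<in> Y \<rightarrow>\<^sub>E \<C>\<M> (labels \<Sigma> \<times> Z)"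
    "t \<in> \<C>\<M> (labels \<Sigma> \<times> X)"
  then show "cm_ext g (cm_ext f t) = cm_ext (\<lambda>x\<in>X. cm_ext g (f x)) t"
    by (intro cm_ext_assoc[of X f \<Sigma> Y g Z]) auto
qed


section \<open>Saturated maps and the construction of the saturation\<close>

text \<open>The reflexive and transitive Kleisli endomorphisms: the conditions on
  \<open>\<beta>\<close> in (4) that do not mention \<open>\<alpha>\<close>.\<close>

definition saturated :: "'s set \<Rightarrow> 'u set \<Rightarrow> ('u \<Rightarrow> ('s option \<times> 'u \<Rightarrow> real) set) \<Rightarrow> bool" where
  "saturated \<Sigma> X \<beta> \<longleftrightarrow> \<beta> \<in> X \<rightarrow>\<^sub>E \<C>\<M> (labels \<Sigma> \<times> X) \<and>
     (\<forall>x\<in>X. cm_unit x \<subseteq> \<beta> x \<and> cm_ext \<beta> (\<beta> x) \<subseteq> \<beta> x)"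

definition cm_star :: "'s set \<Rightarrow> 'u set \<Rightarrow> ('u \<Rightarrow> ('s option \<times> 'u \<Rightarrow> real) set) \<Rightarrow>
    'u \<Rightarrow> ('s option \<times> 'u \<Rightarrow> real) set" where
  "cm_star \<Sigma> X \<alpha> = (\<lambda>x\<in>X. \<Inter>\<beta>\<in>{\<beta>. saturated \<Sigma> X \<beta> \<and> (\<forall>x\<in>X. \<alpha> x \<subseteq> \<beta> x)}. \<beta> x)"

lemma saturatedD:
  assumes "saturated \<Sigma> X \<beta>" "x \<in> X"
  shows "\<beta> x \<in> \<C>\<M> (labels \<Sigma> \<times> X)" "\<beta> x \<subseteq> \<M> (labels \<Sigma> \<times> X)" "single (None, x) \<in> \<beta> x"
    "cm_ext \<beta> (\<beta> x) \<subseteq> \<beta> x"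
  using assms by (auto simp: saturated_def cm_unit_def \<C>\<M>_def)

lemma convex_set_Inter: "(\<And>U. U \<in> \<U> \<Longrightarrow> convex_set U) \<Longrightarrow> convex_set (\<Inter>\<U>)"
  unfolding convex_set_def by blast

lemma convex_set_Int: "convex_set U \<Longrightarrow> convex_set V \<Longrightarrow> convex_set (U \<inter> V)"
  unfolding convex_set_def by blast

lemma convex_set_M: "convex_set (\<M> A)"
  by (auto simp: convex_set_def intro!: sum_scale_in_M)

lemma M_in_CM: "\<M> A \<in> \<C>\<M> A"
proof -
  \<comment> \<open>The zero function is a witness for nonemptiness even if \<open>A\<close> is
    empty.\<close>
  have "(\<lambda>_. 0) \<in> \<M> A"
    by (simp add: \<M>_def supp_def)
  then show ?thesis
    using convex_set_M by (auto simp: \<C>\<M>_def)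
qed

text \<open>The greatest Kleisli endomorphism. It makes the family intersected in
  \<open>cm_star\<close> nonempty, which keeps the intersection inside
  \<open>\<M> (labels \<Sigma> \<times> X)\<close>.\<close>

lemma saturated_M: "saturated \<Sigma> X (\<lambda>x\<in>X. \<M> (labels \<Sigma> \<times> X))" (is "saturated _ _ ?\<beta>")
proof -
  have *: "?\<beta> x \<in> \<C>\<M> (labels \<Sigma> \<times> X)" if "x \<in> X" for x
    using that by (simp add: M_in_CM)
  have "cm_ext ?\<beta> (?\<beta> x) \<subseteq> \<M> (labels \<Sigma> \<times> X)" if "x \<in> X" for x
    using cm_ext_in_CM[of X ?\<beta>, OF * *[OF that]] by (simp add: \<C>\<M>_def)
  then show ?thesis
    using * single_in_M[of _ "labels \<Sigma> \<times> X"] by (auto simp: saturated_def cm_unit_def labels_def)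
qed

lemma cm_star_least:
  assumes "saturated \<Sigma> X \<beta>" "\<And>x. x \<in> X \<Longrightarrow> \<alpha> x \<subseteq> \<beta> x" "x \<in> X"
  shows "cm_star \<Sigma> X \<alpha> x \<subseteq> \<beta> x"
  using assms by (auto simp: cm_star_def)

lemma le_cm_star: "x \<in> X \<Longrightarrow> \<alpha> x \<subseteq> cm_star \<Sigma> X \<alpha> x"
  by (auto simp: cm_star_def)

text \<open>All properties pass to the intersection. The unit lies in every member, so the values
  are nonempty. By monotonicity the self-composite of the intersection lies below that of each
  member, hence below the member.\<close>

lemma saturated_cm_star:
  assumes "\<alpha> \<in> X \<rightarrow>\<^sub>E \<C>\<M> (labels \<Sigma> \<times> X)"
  shows "saturated \<Sigma> X (cm_star \<Sigma> X \<alpha>)"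
proof -
  let ?B = "{\<beta>. saturated \<Sigma> X \<beta> \<and> (\<forall>x\<in>X. \<alpha> x \<subseteq> \<beta> x)}"
  have unit: "cm_unit x \<subseteq> cm_star \<Sigma> X \<alpha> x" if "x \<in> X" for x
    using that by (auto simp: cm_star_def saturated_def)
  have "\<alpha> x \<subseteq> \<M> (labels \<Sigma> \<times> X)" if "x \<in> X" for x
    using assms that by (auto simp: \<C>\<M>_def)
  then have M: "cm_star \<Sigma> X \<alpha> x \<subseteq> \<M> (labels \<Sigma> \<times> X)" if "x \<in> X" for x
    using cm_star_least[OF saturated_M, of X \<alpha> \<Sigma> x] that by simp
  have "convex_set (cm_star \<Sigma> X \<alpha> x)" if "x \<in> X" for x
    using that saturatedD(1)[of \<Sigma> X _ x]
    by (auto simp: cm_star_def \<C>\<M>_def intro!: convex_set_Inter)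
  then have CM: "cm_star \<Sigma> X \<alpha> x \<in> \<C>\<M> (labels \<Sigma> \<times> X)" if "x \<in> X" for x
    using that unit[OF that] M[OF that] by (auto simp: \<C>\<M>_def cm_unit_def)
  have "cm_ext (cm_star \<Sigma> X \<alpha>) (cm_star \<Sigma> X \<alpha> x) \<subseteq> \<beta> x" if "x \<in> X" "\<beta> \<in> ?B" for x \<beta>
  proof -
    have "cm_ext (cm_star \<Sigma> X \<alpha>) (cm_star \<Sigma> X \<alpha> x) \<subseteq> cm_ext \<beta> (\<beta> x)"
      using that saturatedD(2)[of \<Sigma> X \<beta> x]
      by (intro cm_ext_mono[of _ _ "labels \<Sigma>" X] cm_star_least) auto
    also have "\<dots> \<subseteq> \<beta> x"
      using that by (auto dest: saturatedD(4))
    finally show ?thesis .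
  qed
  then have "cm_ext (cm_star \<Sigma> X \<alpha>) (cm_star \<Sigma> X \<alpha> x) \<subseteq> (\<Inter>\<beta>\<in>?B. \<beta> x)" if "x \<in> X" for x
    using that by blast
  then have "cm_ext (cm_star \<Sigma> X \<alpha>) (cm_star \<Sigma> X \<alpha> x) \<subseteq> cm_star \<Sigma> X \<alpha> x" if "x \<in> X" for x
    using that by (simp add: cm_star_def)
  moreover have "cm_star \<Sigma> X \<alpha> \<in> X \<rightarrow>\<^sub>E \<C>\<M> (labels \<Sigma> \<times> X)"
    using CM by (auto simp: PiE_iff cm_star_def)
  ultimately show ?thesis
    using unit by (simp add: saturated_def)
qed

section \<open>Compatibility of the saturation with maps\<close>

text \<open>\<open>push f\<close> is linear, so it pulls convex sets back to convex sets.\<close>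

lemma convex_set_push_vimage:
  assumes "convex_set V"
  shows "convex_set {\<phi> \<in> \<M> A. push f \<phi> \<in> V}"
  unfolding convex_set_def
proof (intro allI impI)
  fix n :: nat and a :: "nat \<Rightarrow> real" and \<phi>
  assume *: "\<forall>i<n. 0 \<le> a i \<and> \<phi> i \<in> {\<phi> \<in> \<M> A. push f \<phi> \<in> V}" and one: "(\<Sum>i<n. a i) = 1"
  have "push f (\<Sum>i<n. scale (a i) (\<phi> i)) = (\<Sum>i<n. scale (a i) (push f (\<phi> i)))"
    unfolding push_def using * by (intro kbind_sum_scale) (auto simp: \<M>_def)
  also have "\<dots> \<in> V"
    using assms * one by (simp add: convex_set_def)
  finally show "(\<Sum>i<n. scale (a i) (\<phi> i)) \<in> {\<phi> \<in> \<M> A. push f \<phi> \<in> V}"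
    using * by (auto intro!: sum_scale_in_M)
qed

lemma push_single: "push f (single (None, x)) = single (None, f x)"
  by (simp add: push_def kbind_def supp_single scale_def) (simp add: single_def)

lemma cm_star_push_le:
  assumes \<alpha>: "\<alpha> \<in> X \<rightarrow>\<^sub>E \<C>\<M> (labels \<Sigma> \<times> X)" and \<beta>: "\<beta> \<in> Y \<rightarrow>\<^sub>E \<C>\<M> (labels \<Sigma> \<times> Y)"
    and f: "f \<in> X \<rightarrow> Y" and le: "\<And>x. x \<in> X \<Longrightarrow> push f ` \<alpha> x \<subseteq> \<beta> (f x)" and "x \<in> X"
  shows "push f ` cm_star \<Sigma> X \<alpha> x \<subseteq> cm_star \<Sigma> Y \<beta> (f x)"
proof -
  let ?L = "labels \<Sigma>"
  let ?F = "\<lambda>x\<in>X. cm_unit (f x)"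
  define b where "b = cm_star \<Sigma> Y \<beta>"
  have b: "saturated \<Sigma> Y b"
    unfolding b_def using \<beta> by (rule saturated_cm_star)
  define \<gamma> where "\<gamma> = (\<lambda>x\<in>X. {\<phi> \<in> \<M> (?L \<times> X). push f \<phi> \<in> b (f x)})"
  have fx: "f x \<in> Y" if "x \<in> X" for x
    using f that by blast
  have unit: "single (None, x) \<in> \<gamma> x" if "x \<in> X" for x
    using that saturatedD(3)[OF b fx[OF that]]
    by (auto simp: \<gamma>_def push_single labels_def intro!: single_in_M)
  have \<gamma>M: "\<gamma> x \<subseteq> \<M> (?L \<times> X)" if "x \<in> X" for x
    using that by (auto simp: \<gamma>_def)
  have \<gamma>: "\<gamma> x \<in> \<C>\<M> (?L \<times> X)" if "x \<in> X" for x
    using that unit[OF that] \<gamma>M[OF that] saturatedD(1)[OF b fx[OF that]]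
    by (auto simp: \<gamma>_def \<C>\<M>_def intro: convex_set_push_vimage)
  have F: "?F x \<in> \<C>\<M> (?L \<times> Y)" if "x \<in> X" for x
    using that fx by (simp add: cm_unit_in_CM)
  have F\<gamma>: "cm_ext ?F (\<gamma> x) \<subseteq> b (f x)" if "x \<in> X" for x
    unfolding cm_ext_sharp[OF \<gamma>M[OF that]] using that by (auto simp: \<gamma>_def)
  \<comment> \<open>With \<open>F\<close> for \<open>f\<^sup>\<sharp>\<close>, the chain is \<open>F
    \<bullet> \<gamma> \<bullet> \<gamma> \<le> b \<bullet> F \<bullet> \<gamma> \<le> b \<bullet> b
    \<bullet> F \<le> b \<bullet> F\<close>, and membership in \<open>\<gamma> x\<close> is exactly
    this final bound together with membership in \<open>\<M>\<close>.\<close>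
  have comp: "cm_ext \<gamma> (\<gamma> x) \<subseteq> \<gamma> x" if x: "x \<in> X" for x
  proof -
    have M: "cm_ext \<gamma> (\<gamma> x) \<subseteq> \<M> (?L \<times> X)"
      using cm_ext_in_CM[OF \<gamma> \<gamma>[OF x]] by (simp add: \<C>\<M>_def)
    have "push f ` cm_ext \<gamma> (\<gamma> x) = cm_ext ?F (cm_ext \<gamma> (\<gamma> x))"
      by (rule cm_ext_sharp[OF M, symmetric])
    also have "\<dots> = cm_ext (\<lambda>x\<in>X. cm_ext ?F (\<gamma> x)) (\<gamma> x)"
      by (rule cm_ext_assoc[OF \<gamma> F \<gamma>[OF x]])
    also have "\<dots> \<subseteq> cm_ext (\<lambda>x\<in>X. cm_ext b (?F x)) (\<gamma> x)"
      using F\<gamma> by (intro cm_ext_mono[OF _ \<gamma>M[OF x]]) (simp_all add: cm_ext_apply_unit)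
    also have "\<dots> = cm_ext b (cm_ext ?F (\<gamma> x))"
      by (rule cm_ext_assoc[OF F saturatedD(1)[OF b] \<gamma>[OF x], symmetric])
    also have "\<dots> \<subseteq> cm_ext b (b (f x))"
      by (rule cm_ext_mono[OF F\<gamma>[OF x] saturatedD(2)[OF b fx[OF x]]]) simp
    also have "\<dots> \<subseteq> b (f x)"
      by (rule saturatedD(4)[OF b fx[OF x]])
    finally show ?thesis
      using M x by (auto simp: \<gamma>_def)
  qed
  have "saturated \<Sigma> X \<gamma>"
    unfolding saturated_def using \<gamma> unit comp by (auto simp: PiE_iff cm_unit_def \<gamma>_def)
  moreover have "\<alpha> x \<subseteq> \<gamma> x" if "x \<in> X" for x
  proof -
    have "\<alpha> x \<subseteq> \<M> (?L \<times> X)"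
      using \<alpha> that by (auto simp: \<C>\<M>_def)
    moreover have "push f ` \<alpha> x \<subseteq> b (f x)"
      unfolding b_def using le[OF that] le_cm_star[OF fx[OF that], of \<beta> \<Sigma>] by blast
    ultimately show ?thesis
      using that by (auto simp: \<gamma>_def)
  qed
  ultimately have "cm_star \<Sigma> X \<alpha> x \<subseteq> \<gamma> x"
    using \<open>x \<in> X\<close> by (rule cm_star_least)
  then show ?thesis
    using \<open>x \<in> X\<close> by (auto simp: \<gamma>_def b_def)
qed

lemma cm_star_le_push:
  assumes \<alpha>: "\<alpha> \<in> X \<rightarrow>\<^sub>E \<C>\<M> (labels \<Sigma> \<times> X)" and \<beta>: "\<beta> \<in> Y \<rightarrow>\<^sub>E \<C>\<M> (labels \<Sigma> \<times> Y)"
    and f: "f \<in> X \<rightarrow> Y" and le: "\<And>x. x \<in> X \<Longrightarrow> \<beta> (f x) \<subseteq> push f ` \<alpha> x" and "x \<in> X"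
  shows "cm_star \<Sigma> Y \<beta> (f x) \<subseteq> push f ` cm_star \<Sigma> X \<alpha> x"
proof -
  let ?L = "labels \<Sigma>"
  let ?F = "\<lambda>x\<in>X. cm_unit (f x)"
  define a where "a = cm_star \<Sigma> X \<alpha>"
  have a: "saturated \<Sigma> X a"
    unfolding a_def using \<alpha> by (rule saturated_cm_star)
  \<comment> \<open>A state \<open>y\<close> may have several preimages under \<open>f\<close>,
    hence the intersection over the fibre. Over an empty fibre that intersection is the universe,
    and the factor \<open>\<M> (?L \<times> Y)\<close> leaves the greatest admissible value.\<close>
  define \<delta> where "\<delta> = (\<lambda>y\<in>Y. \<M> (?L \<times> Y) \<inter> \<Inter>{cm_ext ?F (a x) | x. x \<in> X \<and> f x = y})"
  have fx: "f x \<in> Y" if "x \<in> X" for x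
    using f that by blast
  have F: "?F x \<in> \<C>\<M> (?L \<times> Y)" if "x \<in> X" for x
    using that fx by (simp add: cm_unit_in_CM)
  have Fa: "cm_ext ?F (a x) \<in> \<C>\<M> (?L \<times> Y)" if "x \<in> X" for x
    using cm_ext_in_CM[OF F saturatedD(1)[OF a that]] .
  have Fa_push: "cm_ext ?F (a x) = push f ` a x" if "x \<in> X" for x
    by (rule cm_ext_sharp[OF saturatedD(2)[OF a that]])
  have unit: "single (None, y) \<in> \<delta> y" if "y \<in> Y" for y
  proof -
    have "single (None, f x) \<in> cm_ext ?F (a x)" if "x \<in> X" for x
      unfolding Fa_push[OF that] using saturatedD(3)[OF a that] push_single[of f x] by (metis imageI)
    then show ?thesis
      using that by (auto simp: \<delta>_def labels_def intro!: single_in_M)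
  qed
  have \<delta>M: "\<delta> y \<subseteq> \<M> (?L \<times> Y)" if "y \<in> Y" for y
    using that by (auto simp: \<delta>_def)
  have "convex_set (\<delta> y)" if "y \<in> Y" for y
    using that Fa by (auto simp: \<delta>_def \<C>\<M>_def intro!: convex_set_Int convex_set_M convex_set_Inter)
  then have \<delta>: "\<delta> y \<in> \<C>\<M> (?L \<times> Y)" if "y \<in> Y" for y
    using that unit[OF that] \<delta>M[OF that] by (auto simp: \<C>\<M>_def)
  have \<delta>F: "\<delta> (f x) \<subseteq> cm_ext ?F (a x)" if "x \<in> X" for x
    using that fx[OF that] by (auto simp: \<delta>_def)
  \<comment> \<open>The dual chain: \<open>\<delta> \<bullet> \<delta> \<bullet> F \<le> \<delta>
    \<bullet> F \<bullet> a \<le> F \<bullet> a \<bullet> a \<le> F \<bullet> a\<close>.\<close>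
  have comp_f: "cm_ext \<delta> (\<delta> (f x)) \<subseteq> cm_ext ?F (a x)" if x: "x \<in> X" for x
  proof -
    have "cm_ext \<delta> (\<delta> (f x)) \<subseteq> cm_ext \<delta> (cm_ext ?F (a x))"
      using Fa[OF x] by (intro cm_ext_mono[of _ _ ?L Y] \<delta>F[OF x]) (auto simp: \<C>\<M>_def)
    also have "\<dots> = cm_ext (\<lambda>x\<in>X. cm_ext \<delta> (?F x)) (a x)"
      by (rule cm_ext_assoc[OF F \<delta> saturatedD(1)[OF a x]])
    also have "\<dots> \<subseteq> cm_ext (\<lambda>x\<in>X. cm_ext ?F (a x)) (a x)"
      using \<delta>F by (intro cm_ext_mono[OF _ saturatedD(2)[OF a x]]) (simp_all add: cm_ext_apply_unit)
    also have "\<dots> = cm_ext ?F (cm_ext a (a x))"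
      by (rule cm_ext_assoc[OF saturatedD(1)[OF a] F saturatedD(1)[OF a x], symmetric])
    also have "\<dots> \<subseteq> cm_ext ?F (a x)"
      by (rule cm_ext_mono[OF saturatedD(4)[OF a x] saturatedD(2)[OF a x]]) simp
    finally show ?thesis .
  qed
  \<comment> \<open>Each set in the intersection belongs to some \<open>x\<close> with
    \<open>f x = y\<close>, where \<open>comp_f\<close> applies; for \<open>y\<close> outside the
    image of \<open>f\<close> only the bound by \<open>\<M>\<close> remains.\<close>
  have comp: "cm_ext \<delta> (\<delta> y) \<subseteq> \<delta> y" if y: "y \<in> Y" for y
  proof -
    have "cm_ext \<delta> (\<delta> y) \<subseteq> \<M> (?L \<times> Y)"
      using cm_ext_in_CM[OF \<delta> \<delta>[OF y]] by (simp add: \<C>\<M>_def)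
    moreover have "cm_ext \<delta> (\<delta> y) \<subseteq> \<Inter>{cm_ext ?F (a x) | x. x \<in> X \<and> f x = y}"
      using comp_f by blast
    moreover have "\<delta> y = \<M> (?L \<times> Y) \<inter> \<Inter>{cm_ext ?F (a x) | x. x \<in> X \<and> f x = y}"
      using y by (simp add: \<delta>_def)
    ultimately show ?thesis
      by (simp only: Int_greatest)
  qed
  have "saturated \<Sigma> Y \<delta>"
    unfolding saturated_def using \<delta> unit comp by (auto simp: PiE_iff cm_unit_def \<delta>_def)
  moreover have "\<beta> y \<subseteq> \<delta> y" if "y \<in> Y" for y
  proof -
    have "\<beta> y \<subseteq> \<M> (?L \<times> Y)"
      using \<beta> that by (auto simp: \<C>\<M>_def)
    moreover have "\<beta> (f x) \<subseteq> cm_ext ?F (a x)" if "x \<in> X" for x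
      unfolding Fa_push[OF that] unfolding a_def
      using le[OF that] le_cm_star[OF that, of \<alpha> \<Sigma>] by blast
    ultimately show ?thesis
      using that by (auto simp: \<delta>_def)
  qed
  ultimately have "cm_star \<Sigma> Y \<beta> (f x) \<subseteq> \<delta> (f x)"
    using fx[OF \<open>x \<in> X\<close>] by (rule cm_star_least)
  also have "\<dots> \<subseteq> push f ` a x"
    using \<delta>F[OF \<open>x \<in> X\<close>] Fa_push[OF \<open>x \<in> X\<close>] by simp
  finally show ?thesis
    by (simp add: a_def)
qed

section \<open>Order axioms and conditions (1) to (5)\<close>

theorem theorem8p10:
  fixes \<Sigma> :: "'s set"
  shows "ordered_saturation_monad
    (\<lambda>X :: 'u set. \<C>\<M> (labels \<Sigma> \<times> X))
    (\<lambda>X. cm_unit)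
    (\<lambda>X Y. cm_ext)
    (\<lambda>X Y f g. \<forall>x\<in>X. f x \<subseteq> g x)"
proof -
  interpret kleisli_triple "\<lambda>X :: 'u set. \<C>\<M> (labels \<Sigma> \<times> X)" "\<lambda>X. cm_unit" "\<lambda>X Y. cm_ext"
    by (rule kleisli_triple_CM)
  have M: "\<alpha> x \<subseteq> \<M> (labels \<Sigma> \<times> Y)" if "\<alpha> \<in> hom X Y" "x \<in> X" for \<alpha> X Y x
    using that unfolding hom_def by (auto simp: \<C>\<M>_def)
  \<comment> \<open>This identity and the next turn condition (5) into the inclusions of
    \<open>cm_star_push_le\<close> and \<open>cm_star_le_push\<close>.\<close>
  have sharp_comp: "kcomp X X Y (sharp X Y f) \<alpha> x = push f ` \<alpha> x"
    if "\<alpha> \<in> hom X X" "x \<in> X" for X Y f \<alpha> x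
    using that cm_ext_sharp[OF M[OF that]] by (simp add: kcomp_def sharp_def)
  have comp_sharp: "kcomp X Y Y \<beta> (sharp X Y f) x = \<beta> (f x)" if "x \<in> X" for X Y f \<beta> x
    using that by (simp add: kcomp_def sharp_def cm_ext_apply_unit)
  have sat: "saturated \<Sigma> X \<beta> \<longleftrightarrow> \<beta> \<in> hom X X \<and> (\<forall>x\<in>X. kid X x \<subseteq> \<beta> x) \<and>
      (\<forall>x\<in>X. kcomp X X X \<beta> \<beta> x \<subseteq> \<beta> x)" for X \<beta>
    by (auto simp: saturated_def hom_def kid_def kcomp_def)
  have star: "saturated \<Sigma> X (cm_star \<Sigma> X \<alpha>)" if "\<alpha> \<in> hom X X" for X \<alpha>
    using that unfolding hom_def by (rule saturated_cm_star)
  have star_hom: "cm_star \<Sigma> X \<alpha> \<in> hom X X" if "\<alpha> \<in> hom X X" for X \<alpha>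
    using star[OF that] sat by blast
  show ?thesis
  proof (unfold_locales, goal_cases)
    case (1 X Y)
    show ?case by (simp add: reflp_on_def)
  next
    case (2 X Y)
    \<comment> \<open>Mutual inclusion gives equality on \<open>X\<close>; outside \<open>X\<close>
      both maps are \<open>undefined\<close>, being extensional.\<close>
    show ?case
      unfolding antisymp_on_def hom_def by (meson PiE_ext subset_antisym)
  next
    case (3 X Y)
    show ?case unfolding transp_on_def by blast
  next
    case (4 f X Y f' g Z g')
    have "cm_ext g (f x) \<subseteq> cm_ext g' (f' x)" if "x \<in> X" for x
      by (rule cm_ext_mono[OF _ M[OF 4(2) that]]) (use 4 that in blast)+
    then show ?case
      by (simp add: kcomp_def)
  next
    case 5
    show ?case
    proof (intro exI[of _ "cm_star \<Sigma>"] conjI allI ballI impI)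
      fix X and \<alpha> assume \<alpha>: "\<alpha> \<in> hom X X"
      show "cm_star \<Sigma> X \<alpha> \<in> hom X X"
        by (rule star_hom[OF \<alpha>])
      fix x assume x: "x \<in> X"
      show "kid X x \<subseteq> cm_star \<Sigma> X \<alpha> x"
        "kcomp X X X (cm_star \<Sigma> X \<alpha>) (cm_star \<Sigma> X \<alpha>) x \<subseteq> cm_star \<Sigma> X \<alpha> x"
        using star[OF \<alpha>] x unfolding sat by blast+
      show "\<alpha> x \<subseteq> cm_star \<Sigma> X \<alpha> x"
        using x by (rule le_cm_star)
      fix \<beta>
      assume "\<beta> \<in> hom X X" "\<forall>x\<in>X. kid X x \<subseteq> \<beta> x" "\<forall>x\<in>X. \<alpha> x \<subseteq> \<beta> x"
        "\<forall>x\<in>X. kcomp X X X \<beta> \<beta> x \<subseteq> \<beta> x"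
      then show "cm_star \<Sigma> X \<alpha> x \<subseteq> \<beta> x"
        using x sat by (intro cm_star_least) blast+
    next
      fix X Y \<alpha> \<beta> f x
      assume *: "\<alpha> \<in> hom X X" "\<beta> \<in> hom Y Y" "f \<in> X \<rightarrow> Y" "x \<in> X"
        "\<forall>x\<in>X. kcomp X X Y (sharp X Y f) \<alpha> x \<subseteq> kcomp X Y Y \<beta> (sharp X Y f) x"
      then show "kcomp X X Y (sharp X Y f) (cm_star \<Sigma> X \<alpha>) x
          \<subseteq> kcomp X Y Y (cm_star \<Sigma> Y \<beta>) (sharp X Y f) x"
        using cm_star_push_le[of \<alpha> X \<Sigma> \<beta> Y f x] star_hom[OF *(1)]
        by (simp add: sharp_comp comp_sharp hom_def[symmetric])
    next
      fix X Y \<alpha> \<beta> f x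
      assume *: "\<alpha> \<in> hom X X" "\<beta> \<in> hom Y Y" "f \<in> X \<rightarrow> Y" "x \<in> X"
        "\<forall>x\<in>X. kcomp X Y Y \<beta> (sharp X Y f) x \<subseteq> kcomp X X Y (sharp X Y f) \<alpha> x"
      then show "kcomp X Y Y (cm_star \<Sigma> Y \<beta>) (sharp X Y f) x
          \<subseteq> kcomp X X Y (sharp X Y f) (cm_star \<Sigma> X \<alpha>) x"
        using cm_star_le_push[of \<alpha> X \<Sigma> \<beta> Y f x] star_hom[OF *(1)]
        by (simp add: sharp_comp comp_sharp hom_def[symmetric])
    qed
  qed
qed

end
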